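(* Let $V=\bigoplus_{n=0}^{\infty}V_n$ be an $\mathbb{N}$-graded vertex algebra such that $1<\dim V_0<\infty$, $\dim V_i<\infty$ for all $i\ge 1$, and $\ker(D|_{V_0})=\mathbb{C}\mathbf 1$. Let $\mathfrak g$ be a semisimple Lie subalgebra of $V_1$. Define a bilinear map $(\,,\,):\mathfrak g\times\mathfrak g\to\mathbb{C}$ by $(u,v)\mathbf 1=u_1v$ for $u,v\in\mathfrak g$. Then $(\,,\,)$ is an invariant symmetric bilinear form on $\mathfrak g$, i.e. $(u,v)=(v,u)$ and $([u,v],w)=(u,[v,w])$ for all $u,v,w\in\mathfrak g$. (In particular $u_1v\in\mathbb{C}\mathbf 1$ for $u,v\in \mathfrak g$, so that the map is well defined.)
   Context: All spaces are over $\mathbb{C}$. For a vertex algebra $(V,Y,\mathbf 1)$ write $Y(v,x)=\sum_{n\in\mathbb{Z}}v_nx^{-n-1}$; $D$ is the canonical translation operator $D(v)=v_{-2}\mathbf 1$. $\mathbb{N}$-graded means $V=\bigoplus_{n\ge0}V_n$ with $\mathbf 1\in V_0$ and $u_nv\in V_{p+q-n-1}$ for $u\in V_p$, $v\in V_q$. The space $V_1$ is a left Leibniz algebra under $[b,b']=b_0b'$. A semisimple Lie subalgebra $\mathfrak g$ of $V_1$ is a subspace closed under $[u,v]=u_0v$ on which this bracket is a (skew-symmetric) Lie bracket making $\mathfrak g$ a semisimple Lie algebra. *)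

theory Defs
  imports Complex_Main "HOL-Library.Groups_Big_Fun"
begin

text \<open>The library's \<open>dim\<close> is a natural number, with value 0 on infinite-dimensional
  spaces, so finiteness of the dimension is a separate predicate.\<close>

definition fin_dim ::
  "('a::field \<Rightarrow> 'b::ab_group_add \<Rightarrow> 'b) \<Rightarrow> 'b set \<Rightarrow> bool" where
  "fin_dim scale S \<longleftrightarrow> (\<exists>B. finite B \<and> S \<subseteq> module.span scale B)"

definition bilinear_on ::
  "('a::field \<Rightarrow> 'b::ab_group_add \<Rightarrow> 'b) \<Rightarrow> 'b set \<Rightarrow> ('b \<Rightarrow> 'b \<Rightarrow> 'b) \<Rightarrow> bool" where
  "bilinear_on scale L br \<longleftrightarrow>
     (\<forall>x\<in>L. \<forall>y\<in>L. \<forall>z\<in>L. br (x + y) z = br x z + br y z \<and> br z (x + y) = br z x + br z y) \<and>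
     (\<forall>c. \<forall>x\<in>L. \<forall>y\<in>L. br (scale c x) y = scale c (br x y) \<and> br x (scale c y) = scale c (br x y))"

definition bilinear_form_on ::
  "('a::field \<Rightarrow> 'b::ab_group_add \<Rightarrow> 'b) \<Rightarrow> 'b set \<Rightarrow> ('b \<Rightarrow> 'b \<Rightarrow> 'a) \<Rightarrow> bool" where
  "bilinear_form_on scale L \<beta> \<longleftrightarrow>
     (\<forall>x\<in>L. \<forall>y\<in>L. \<forall>z\<in>L. \<beta> (x + y) z = \<beta> x z + \<beta> y z \<and> \<beta> z (x + y) = \<beta> z x + \<beta> z y) \<and>
     (\<forall>c. \<forall>x\<in>L. \<forall>y\<in>L. \<beta> (scale c x) y = c * \<beta> x y \<and> \<beta> x (scale c y) = c * \<beta> x y)"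

definition lie_algebra_on ::
  "('a::field \<Rightarrow> 'b::ab_group_add \<Rightarrow> 'b) \<Rightarrow> 'b set \<Rightarrow> ('b \<Rightarrow> 'b \<Rightarrow> 'b) \<Rightarrow> bool" where
  "lie_algebra_on scale L br \<longleftrightarrow>
     module.subspace scale L \<and> (\<forall>x\<in>L. \<forall>y\<in>L. br x y \<in> L) \<and> bilinear_on scale L br \<and>
     (\<forall>x\<in>L. br x x = 0) \<and>
     (\<forall>x\<in>L. \<forall>y\<in>L. \<forall>z\<in>L. br x (br y z) + br y (br z x) + br z (br x y) = 0)"

definition lie_ideal ::
  "('a::field \<Rightarrow> 'b::ab_group_add \<Rightarrow> 'b) \<Rightarrow> 'b set \<Rightarrow> 'b set \<Rightarrow> ('b \<Rightarrow> 'b \<Rightarrow> 'b) \<Rightarrow> bool" where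
  "lie_ideal scale I L br \<longleftrightarrow> module.subspace scale I \<and> I \<subseteq> L \<and> (\<forall>x\<in>L. \<forall>y\<in>I. br x y \<in> I)"

definition derived_algebra ::
  "('a::field \<Rightarrow> 'b::ab_group_add \<Rightarrow> 'b) \<Rightarrow> ('b \<Rightarrow> 'b \<Rightarrow> 'b) \<Rightarrow> 'b set \<Rightarrow> 'b set" where
  "derived_algebra scale br L = module.span scale {br x y | x y. x \<in> L \<and> y \<in> L}"

definition lie_solvable ::
  "('a::field \<Rightarrow> 'b::ab_group_add \<Rightarrow> 'b) \<Rightarrow> 'b set \<Rightarrow> ('b \<Rightarrow> 'b \<Rightarrow> 'b) \<Rightarrow> bool" where
  "lie_solvable scale L br \<longleftrightarrow> (\<exists>k. (derived_algebra scale br ^^ k) L = {0})"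

definition semisimple_lie_algebra_on ::
  "('a::field \<Rightarrow> 'b::ab_group_add \<Rightarrow> 'b) \<Rightarrow> 'b set \<Rightarrow> ('b \<Rightarrow> 'b \<Rightarrow> 'b) \<Rightarrow> bool" where
  "semisimple_lie_algebra_on scale L br \<longleftrightarrow>
     lie_algebra_on scale L br \<and> fin_dim scale L \<and>
     (\<forall>I. lie_ideal scale I L br \<and> lie_solvable scale I br \<longrightarrow> I = {0})"

definition symmetric_on :: "'v set \<Rightarrow> ('v \<Rightarrow> 'v \<Rightarrow> 'a) \<Rightarrow> bool" where
  "symmetric_on L \<beta> \<longleftrightarrow> (\<forall>u\<in>L. \<forall>v\<in>L. \<beta> u v = \<beta> v u)"

definition invariant_on :: "'v set \<Rightarrow> ('v \<Rightarrow> 'v \<Rightarrow> 'v) \<Rightarrow> ('v \<Rightarrow> 'v \<Rightarrow> 'a) \<Rightarrow> bool" where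
  "invariant_on L br \<beta> \<longleftrightarrow> (\<forall>u\<in>L. \<forall>v\<in>L. \<forall>w\<in>L. \<beta> (br u v) w = \<beta> u (br v w))"

text \<open>\<open>Y u n v\<close> is the mode product \<open>u\<^sub>n v\<close>, i.e. the coefficient of
  \<open>x\<^sup>-\<^sup>n\<^sup>-\<^sup>1\<close> in \<open>Y(u,x)v\<close>.  The axiom \<open>jacobi\<close> is the Jacobi identity
  \[
    x_0^{-1}\delta\Big(\frac{x_1-x_2}{x_0}\Big)Y(u,x_1)Y(v,x_2)w
    - x_0^{-1}\delta\Big(\frac{x_2-x_1}{-x_0}\Big)Y(v,x_2)Y(u,x_1)w
    = x_2^{-1}\delta\Big(\frac{x_1-x_0}{x_2}\Big)Y(Y(u,x_0)v,x_2)w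
  \]
  read off at the coefficient of \<open>x\<^sub>0\<^sup>-\<^sup>l\<^sup>-\<^sup>1 x\<^sub>1\<^sup>-\<^sup>m\<^sup>-\<^sup>1 x\<^sub>2\<^sup>-\<^sup>n\<^sup>-\<^sup>1\<close>,
  for all \<open>l, m, n\<close>.  By \<open>truncation\<close> only finitely many summands on either side are
  nonzero, so \<open>Sum_any\<close> is the actual sum.\<close>

locale vertex_algebra = vector_space scale
  for scale :: "complex \<Rightarrow> 'v::ab_group_add \<Rightarrow> 'v" +
  fixes Y :: "'v \<Rightarrow> int \<Rightarrow> 'v \<Rightarrow> 'v" and vac :: 'v
  assumes linear_left: "Vector_Spaces.linear scale scale (\<lambda>u. Y u n v)"
    and linear_right: "Vector_Spaces.linear scale scale (\<lambda>v. Y u n v)"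
    and truncation: "\<exists>N. \<forall>n\<ge>N. Y u n v = 0"
    and vacuum: "Y vac n v = (if n = -1 then v else 0)"
    and creation: "Y v (-1) vac = v" "n \<ge> 0 \<Longrightarrow> Y v n vac = 0"
    and jacobi:
      "Sum_any (\<lambda>i. scale (of_int m gchoose i) (Y (Y u (l + int i) v) (m + n - int i) w)) =
       Sum_any (\<lambda>i. scale ((-1) ^ i * (of_int l gchoose i))
         (Y u (l + m - int i) (Y v (n + int i) w)
          - scale ((-1) powi l) (Y v (l + n - int i) (Y u (m + int i) w))))"
begin

definition translation :: "'v \<Rightarrow> 'v" where
  "translation v = Y v (-2) vac"

definition lie_bracket :: "'v \<Rightarrow> 'v \<Rightarrow> 'v" where
  "lie_bracket u v = Y u 0 v"

text \<open>A definite description: meaningful only where \<open>u\<^sub>1 v\<close> is a unique scalar multiple of the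
  vacuum.\<close>

definition form :: "'v \<Rightarrow> 'v \<Rightarrow> complex" where
  "form u v = (THE c. scale c vac = Y u 1 v)"

end

text \<open>Homogeneous spaces of negative weight are zero; in \<open>grade_mode\<close> the weight
  \<open>p + q - n - 1\<close> may be negative.\<close>

locale nat_graded_vertex_algebra = vertex_algebra scale Y vac
  for scale :: "complex \<Rightarrow> 'v::ab_group_add \<Rightarrow> 'v" and Y vac +
  fixes V :: "nat \<Rightarrow> 'v set"
  assumes subspace_grade: "subspace (V n)"
    and direct_sum:
      "\<exists>!f. finite {n. f n \<noteq> 0} \<and> (\<forall>n. f n \<in> V n) \<and> v = Sum_any f"
    and vac_grade: "vac \<in> V 0"
    and grade_mode: "u \<in> V p \<Longrightarrow> v \<in> V q \<Longrightarrow>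
      Y u n v \<in> (let k = int p + int q - n - 1 in if k < 0 then {0} else V (nat k))"

end

theory Submission imports Defs begin

text \<open>Skew symmetry of the vertex operators gives \<open>u\<^sub>0 v + v\<^sub>0 u = D (u\<^sub>1 v)\<close> for \<open>u\<close>, \<open>v\<close> of
  weight one.  The bracket \<open>u\<^sub>0 v\<close> is skew-symmetric on \<open>\<gg>\<close>, so \<open>u\<^sub>1 v\<close> lies in the kernel of
  \<open>D\<close> on weight zero, which is the line through the vacuum.  Symmetry of the form is skew
  symmetry one mode higher, and invariance is the commutator formula
  \<open>(u\<^sub>0 v)\<^sub>1 w = u\<^sub>0 (v\<^sub>1 w) - v\<^sub>1 (u\<^sub>0 w)\<close>, whose first term vanishes because \<open>u\<^sub>0\<close> kills the
  vacuum.\<close>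

lemma Sum_any_eq_single:
  assumes "\<And>i. i \<noteq> k \<Longrightarrow> f i = 0"
  shows "Sum_any f = f k"
proof -
  have "Sum_any f = sum f {k}"
    using assms by (intro Sum_any.expand_superset) auto
  then show ?thesis by simp
qed

text \<open>Supplies the coefficients on the left of \<open>jacobi\<close> at \<open>m = -1\<close>,
  the case that yields skew symmetry.\<close>

lemma gbinomial_minus_one: "(-1 :: 'a::field_char_0) gchoose i = (-1) ^ i"
  using gbinomial_minus[of "1::'a" i] binomial_gbinomial[of i i, where 'a = 'a] by simp

context vertex_algebra
begin

lemma mode_add_left: "Y (u + u') n v = Y u n v + Y u' n v"
  using linear_left[of n v] unfolding Vector_Spaces.linear_iff by blast

lemma mode_add_right: "Y u n (v + v') = Y u n v + Y u n v'"
  using linear_right[of u n] unfolding Vector_Spaces.linear_iff by blast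

lemma mode_scale_left: "Y (scale c u) n v = scale c (Y u n v)"
  using linear_left[of n v] unfolding Vector_Spaces.linear_iff by blast

lemma mode_scale_right: "Y u n (scale c v) = scale c (Y u n v)"
  using linear_right[of u n] unfolding Vector_Spaces.linear_iff by blast

lemma mode_zero_left [simp]: "Y 0 n v = 0"
  using mode_scale_left[of 0 0] by simp

lemma mode_zero_right [simp]: "Y u n 0 = 0"
  using mode_scale_right[of u n 0 0] by simp

lemma mode_minus_left: "Y (- u) n v = - Y u n v"
  using mode_scale_left[of "-1" u] by simp

lemma vac_nonzero:
  assumes "(v :: 'v) \<noteq> 0"
  shows "vac \<noteq> 0"
  using creation(1)[of v] assms by auto

text \<open>The Jacobi identity for \<open>w = vac\<close>, \<open>m = -1\<close>, \<open>n = 0\<close>, where on the right-hand side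
  only \<open>v\<^sub>l (u\<^sub>-\<^sub>1 vac)\<close> survives.\<close>

lemma skew_symmetry:
  "Sum_any (\<lambda>i. scale ((-1) ^ i) (Y (Y u (l + int i) v) (-1 - int i) vac)) =
   - scale ((-1) powi l) (Y v l u)"
proof -
  let ?g = "\<lambda>i. scale ((-1) ^ i * (of_int l gchoose i))
         (Y u (l + - 1 - int i) (Y v (0 + int i) vac)
          - scale ((-1) powi l) (Y v (l + 0 - int i) (Y u (- 1 + int i) vac)))"
  have "Sum_any ?g = ?g 0"
    by (rule Sum_any_eq_single) (simp add: creation)
  then show ?thesis
    using jacobi[of "-1" u l v 0 vac] by (simp add: gbinomial_minus_one creation)
qed

text \<open>This is \<open>jacobi\<close> at \<open>l = m = 0\<close>: since
  \<open>0 gchoose i\<close> vanishes for \<open>i > 0\<close>, each side keeps only its term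
  \<open>i = 0\<close>.\<close>

lemma commutator_formula_zero:
  "Y (Y u 0 v) n w = Y u 0 (Y v n w) - Y v n (Y u 0 w)"
proof -
  have "Sum_any (\<lambda>i. scale (of_int 0 gchoose i) (Y (Y u (0 + int i) v) (0 + n - int i) w)) =
      Y (Y u 0 v) n w"
    by (subst Sum_any_eq_single[where k = 0]) (auto simp: gr0_conv_Suc)
  moreover have "Sum_any (\<lambda>i. scale ((-1) ^ i * (of_int 0 gchoose i))
         (Y u (0 + 0 - int i) (Y v (n + int i) w)
          - scale ((-1) powi 0) (Y v (0 + n - int i) (Y u (0 + int i) w)))) =
      Y u 0 (Y v n w) - Y v n (Y u 0 w)"
    by (subst Sum_any_eq_single[where k = 0]) (auto simp: gr0_conv_Suc)
  ultimately show ?thesis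
    using jacobi[of 0 u 0 v n w] by simp
qed

end

context nat_graded_vertex_algebra
begin

text \<open>In \<open>grade_mode\<close> the mode index shares its name with the \<open>nat\<close> index of
  \<open>subspace_grade\<close>, so it is a natural number coerced to \<open>int\<close>: the axiom speaks of modes
  \<open>n \<ge> 0\<close> only.\<close>

lemma weight_one_mode_1:
  assumes "u \<in> V 1" "v \<in> V 1"
  shows "Y u 1 v \<in> V 0"
  using grade_mode[OF assms, where n = 1] by simp

lemma weight_one_mode_ge_2:
  fixes n :: int
  assumes "u \<in> V 1" "v \<in> V 1" "n \<ge> 2"
  shows "Y u n v = 0"
  using grade_mode[OF assms(1,2), where n = "nat n"] assms(3) by simp

text \<open>Skew symmetry at \<open>l = 1\<close>: only \<open>i = 0\<close> survives, and the sign
  \<open>(-1) powi 1\<close> cancels the minus.\<close>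

lemma weight_one_mode_1_commute:
  assumes "u \<in> V 1" "v \<in> V 1"
  shows "Y u 1 v = Y v 1 u"
proof -
  let ?f = "\<lambda>i. scale ((-1) ^ i) (Y (Y u (1 + int i) v) (-1 - int i) vac)"
  have "Sum_any ?f = ?f 0"
    by (rule Sum_any_eq_single) (simp add: weight_one_mode_ge_2[OF assms])
  then show ?thesis
    using skew_symmetry[of u 1 v] by (simp add: creation)
qed

text \<open>Skew symmetry at \<open>l = 0\<close>: the terms \<open>i = 0\<close> and
  \<open>i = 1\<close> survive, and the second one is the translation term.\<close>

lemma weight_one_mode_0_symmetrised:
  assumes "u \<in> V 1" "v \<in> V 1"
  shows "Y u 0 v + Y v 0 u = translation (Y u 1 v)"
proof -
  let ?f = "\<lambda>i. scale ((-1) ^ i) (Y (Y u (0 + int i) v) (-1 - int i) vac)"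
  have "Sum_any ?f = sum ?f {0, 1}"
  proof (rule Sum_any.expand_superset)
    show "{i. ?f i \<noteq> 0} \<subseteq> {0, 1}"
    proof (rule subsetI, rule ccontr)
      fix i assume i: "i \<in> {i. ?f i \<noteq> 0}" "i \<notin> {0, 1}"
      then have "Y u (0 + int i) v = 0"
        by (intro weight_one_mode_ge_2[OF assms]) auto
      with i show False by simp
    qed
  qed simp
  also have "\<dots> = Y u 0 v - translation (Y u 1 v)"
    by (simp add: creation translation_def)
  finally have "- Y v 0 u = Y u 0 v - translation (Y u 1 v)"
    unfolding skew_symmetry by simp
  then show ?thesis
    by (simp add: algebra_simps)
qed

end

text \<open>Polarisation of the alternating law at \<open>x + y\<close>.\<close>

lemma lie_algebra_on_skew:
  assumes "lie_algebra_on scale L br" "x \<in> L" "y \<in> L" "module scale"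
  shows "br x y + br y x = 0"
proof -
  interpret module scale by fact
  have "x + y \<in> L"
    using assms by (auto simp: lie_algebra_on_def intro: subspace_add)
  then have alt: "br (x + y) (x + y) = 0" "br x x = 0" "br y y = 0"
    and add: "br (x + y) (x + y) = br x (x + y) + br y (x + y)"
      "br x (x + y) = br x x + br x y" "br y (x + y) = br y x + br y y"
    using assms unfolding lie_algebra_on_def bilinear_on_def by blast+
  then show ?thesis by simp
qed

theorem corollary3p2:
  fixes scale :: "complex \<Rightarrow> 'v::ab_group_add \<Rightarrow> 'v"
    and Y :: "'v \<Rightarrow> int \<Rightarrow> 'v \<Rightarrow> 'v" and vac :: 'v
    and V :: "nat \<Rightarrow> 'v set" and \<gg> :: "'v set"
  assumes "nat_graded_vertex_algebra scale Y vac V"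
    and "fin_dim scale (V 0)" and "1 < vector_space.dim scale (V 0)"
    and "\<And>i. i \<ge> 1 \<Longrightarrow> fin_dim scale (V i)"
    and "{v \<in> V 0. vertex_algebra.translation Y vac v = 0} = range (\<lambda>c. scale c vac)"
    and "\<gg> \<subseteq> V 1"
    and "semisimple_lie_algebra_on scale \<gg> (vertex_algebra.lie_bracket Y)"
  shows "(\<forall>u\<in>\<gg>. \<forall>v\<in>\<gg>. \<exists>!c. scale c vac = Y u 1 v) \<and>
    bilinear_form_on scale \<gg> (vertex_algebra.form scale Y vac) \<and>
    symmetric_on \<gg> (vertex_algebra.form scale Y vac) \<and>
    invariant_on \<gg> (vertex_algebra.lie_bracket Y) (vertex_algebra.form scale Y vac)"
proof -
  interpret nat_graded_vertex_algebra scale Y vac V by fact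
  have lie: "lie_algebra_on scale \<gg> lie_bracket"
    using assms(7) by (simp add: semisimple_lie_algebra_on_def)
  have closed: "\<And>x y. x \<in> \<gg> \<Longrightarrow> y \<in> \<gg> \<Longrightarrow> Y x 0 y \<in> \<gg>"
    using lie by (auto simp: lie_algebra_on_def lie_bracket_def)
  have skew: "Y x 0 y + Y y 0 x = 0" if "x \<in> \<gg>" "y \<in> \<gg>" for x y
    using lie_algebra_on_skew[OF lie that module_axioms] by (simp add: lie_bracket_def)
  \<comment> \<open>A zero vacuum would make the whole space zero, against
    \<open>1 < dim (V 0)\<close>.\<close>
  have "vac \<noteq> 0"
  proof
    assume "vac = 0"
    then have "V 0 \<subseteq> span {}"
      using vac_nonzero by auto
    then have "dim (V 0) \<le> card ({} :: 'v set)"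
      by (rule dim_le_card) simp
    with assms(3) show False by simp
  qed
  then have inj: "scale c vac = scale d vac \<longleftrightarrow> c = d" for c d
    by simp
  \<comment> \<open>Replaces the definite description by an equation: each law of
    \<open>form\<close> below is proved by comparing coefficients of \<open>vac\<close>.\<close>
  have form_unique: "form u v = c" if "Y u 1 v = scale c vac" for u v c
    unfolding form_def that by (rule the_equality) (simp_all only: inj)
  have scalar: "\<exists>c. Y u 1 v = scale c vac" if "u \<in> \<gg>" "v \<in> \<gg>" for u v
  proof -
    have "u \<in> V 1" "v \<in> V 1" using that assms(6) by auto
    then have "Y u 1 v \<in> {v \<in> V 0. translation v = 0}"
      using weight_one_mode_1 weight_one_mode_0_symmetrised skew[OF that] by auto
    then show ?thesis unfolding assms(5) by blast
  qed
  have form_eq: "Y u 1 v = scale (form u v) vac" if "u \<in> \<gg>" "v \<in> \<gg>" for u v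
    using scalar[OF that] form_unique by auto
  have "\<exists>!c. scale c vac = Y u 1 v" if "u \<in> \<gg>" "v \<in> \<gg>" for u v
    unfolding form_eq[OF that] inj by simp
  moreover have "bilinear_form_on scale \<gg> form"
    unfolding bilinear_form_on_def
    by (intro conjI ballI allI form_unique)
      (simp_all add: mode_add_left mode_add_right mode_scale_left mode_scale_right
        form_eq scale_left_distrib)
  moreover have "form u v = form v u" if "u \<in> \<gg>" "v \<in> \<gg>" for u v
    using weight_one_mode_1_commute[of u v] that assms(6)
    by (intro form_unique) (auto simp: form_eq)
  moreover have "form (Y u 0 v) w = form u (Y v 0 w)" if "u \<in> \<gg>" "v \<in> \<gg>" "w \<in> \<gg>" for u v w
  proof (rule form_unique)
    \<comment> \<open>With \<open>u\<close> and \<open>v\<close> swapped first, the term left by the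
      commutator formula is \<open>Y u 1 (Y v 0 w)\<close> with a plus sign, as required.\<close>
    have "Y u 0 v = - Y v 0 u"
      using skew[OF that(1,2)] by (simp add: eq_neg_iff_add_eq_0)
    then have "Y (Y u 0 v) 1 w = - Y (Y v 0 u) 1 w"
      by (simp add: mode_minus_left)
    also have "\<dots> = Y u 1 (Y v 0 w) - Y v 0 (Y u 1 w)"
      by (simp add: commutator_formula_zero)
    also have "Y v 0 (Y u 1 w) = 0"
      using that by (simp add: form_eq mode_scale_right creation)
    finally show "Y (Y u 0 v) 1 w = scale (form u (Y v 0 w)) vac"
      using that closed by (simp add: form_eq)
  qed
  ultimately show ?thesis
    by (simp add: symmetric_on_def invariant_on_def lie_bracket_def)
qed

end
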